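(* Let $r\ge1$ be an integer. For every non-negative integer $n$, $$\sum_{k=0}^{\lfloor n/2\rfloor}\binom{n-k+r-1}{k}F^{(r)}_{n-2k+1}=\frac12\left((-1)^{\left\lfloor\frac{n}{2r+1}\right\rfloor}-(-1)^{\left\lfloor\frac{n-2}{2r+1}\right\rfloor}\right)=\begin{cases}1&(n\equiv0,1\ (\mathrm{mod}\ 4r+2))\\-1&(n\equiv2r+1,2r+2\ (\mathrm{mod}\ 4r+2))\\0&(\text{otherwise}).\end{cases}$$ For every positive integer $n$, $$2\sum_{k=0}^{\lfloor (n+1)/2\rfloor}\binom{2k-n-1}{k}L^{(r)}_{n-2k}-\sum_{k=0}^{\lfloor n/2\rfloor}\binom{2k-n}{k}L^{(r)}_{n-2k}=(-1)^n\left(-1+(2r+1)\delta_{2r+1\mid n}\right)=\begin{cases}(-1)^{n-1}&(2r+1\nmid n)\\(-1)^n2r&(2r+1\mid n),\end{cases}$$ where, for odd $n$, the term $k=(n+1)/2$ of the first sum (which has coefficient $\binom0k=0$) is read as $0$.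
   Context: For $r\ge1$ put $\alpha_j=-2\cos\left(\frac{2\pi j}{2r+1}\right)$, $j=1,\dots,r$. For $n\ge0$ define $F^{(r)}_{n+1}:=h^{(r)}_n(\alpha_1,\dots,\alpha_r)$ and $L^{(r)}_n:=p^{(r)}_n(\alpha_1,\dots,\alpha_r)$, where $h^{(r)}_n(w_1,\dots,w_r)=\sum_{m_1+\dots+m_r=n}w_1^{m_1}\cdots w_r^{m_r}$ (sum over non-negative integers $m_i$) and $p^{(r)}_n(w_1,\dots,w_r)=\sum_{j=1}^r w_j^n$. For an integer $n$ (possibly negative), $\binom nk=\frac{n(n-1)\cdots(n-k+1)}{k!}$ for $k\ge1$ and $\binom n0=1$. $\delta_{2r+1\mid n}$ is $1$ if $2r+1$ divides $n$ and $0$ otherwise. $\lfloor x\rfloor$ is the greatest integer not exceeding $x$.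
   Formalization: The first identity is false as printed (r=1, n=2 gives 2 on the left and 0 on the right); it is proved with the missing factor (-1)^k inserted in front of the binomial coefficient in the first sum. *)

theory Defs
  imports "HOL-Analysis.Analysis" "HOL-Library.FuncSet" "HOL-Number_Theory.Cong"
begin

definition complete_hom :: "nat \<Rightarrow> nat \<Rightarrow> (nat \<Rightarrow> 'a::comm_semiring_1) \<Rightarrow> 'a" where
  "complete_hom r n w =
     (\<Sum>m | m \<in> {1..r} \<rightarrow>\<^sub>E (UNIV :: nat set) \<and> (\<Sum>j=1..r. m j) = n. \<Prod>j=1..r. w j ^ m j)"

text \<open>The index set of the sum above is finite, so the sum is not degenerate.\<close>

lemma finite_complete_hom_index:
  fixes r n :: nat
  shows "finite {m. m \<in> {1..r} \<rightarrow>\<^sub>E (UNIV :: nat set) \<and> (\<Sum>j=1..r. m j) = n}"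
proof (rule finite_subset)
  show "{m. m \<in> {1..r} \<rightarrow>\<^sub>E (UNIV :: nat set) \<and> (\<Sum>j=1..r. m j) = n} \<subseteq> {1..r} \<rightarrow>\<^sub>E {..n}"
  proof
    fix m assume "m \<in> {m. m \<in> {1..r} \<rightarrow>\<^sub>E (UNIV :: nat set) \<and> (\<Sum>j=1..r. m j) = n}"
    then have m: "m \<in> {1..r} \<rightarrow>\<^sub>E UNIV" and s: "(\<Sum>j=1..r. m j) = n" by auto
    have "m j \<le> n" if "j \<in> {1..r}" for j
      unfolding s[symmetric] using that by (intro member_le_sum) auto
    with m show "m \<in> {1..r} \<rightarrow>\<^sub>E {..n}" by (auto simp: PiE_iff)
  qed
  show "finite ({1..r} \<rightarrow>\<^sub>E {..n})" by (intro finite_PiE) auto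
qed

definition power_sum :: "nat \<Rightarrow> nat \<Rightarrow> (nat \<Rightarrow> 'a::comm_semiring_1) \<Rightarrow> 'a" where
  "power_sum r n w = (\<Sum>j=1..r. w j ^ n)"

definition alpha :: "nat \<Rightarrow> nat \<Rightarrow> real" where
  "alpha r j = - 2 * cos (2 * pi * real j / real (2 * r + 1))"

text \<open>Only indices \<open>n + 1\<close> are meaningful for \<open>genfib\<close>; its value at \<open>0\<close> is a dummy.\<close>

primrec genfib :: "nat \<Rightarrow> nat \<Rightarrow> real" where
  "genfib r 0 = 0"
| "genfib r (Suc n) = complete_hom r n (alpha r)"

definition genluc :: "nat \<Rightarrow> nat \<Rightarrow> real" where
  "genluc r n = power_sum r n (alpha r)"

end

theory Submission
  imports Defs "HOL-Computational_Algebra.Computational_Algebra"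
begin

text \<open>
  Both identities come from substituting \<open>x = X / (1 + X\<^sup>2)\<close> into a generating function in \<open>x\<close>.
  Each factor \<open>1 - \<alpha>\<^sub>j x\<close> then becomes \<open>(1 - \<alpha>\<^sub>j X + X\<^sup>2) / (1 + X\<^sup>2)\<close>, and since
  \<open>\<alpha>\<^sub>j = - (\<zeta>\<^sup>j + \<zeta>\<^sup>-\<^sup>j)\<close> for the root of unity \<open>\<zeta>\<close> of order \<open>N = 2 r + 1\<close>, the numerator splits as
  \<open>(1 + \<zeta>\<^sup>j X) (1 + \<zeta>\<^sup>-\<^sup>j X)\<close>.  On the other side, the coefficients of
  \<open>(X / (1 + X\<^sup>2))\<^sup>i / (1 + X\<^sup>2)\<^sup>s\<close> are binomial coefficients with upper entry \<open>- (i + s)\<close>; so the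
  sums of the theorem are the coefficients of a composed series multiplied by \<open>(1 + X\<^sup>2)\<^sup>-\<^sup>s\<close>
  (\<open>compose_X_over_one_plus_square_nth\<close>).

  For the Fibonacci-type numbers the generating function is \<open>\<Prod>\<^sub>j 1 / (1 - \<alpha>\<^sub>j x)\<close>.  Taking \<open>s = r\<close>
  cancels all the factors \<open>1 + X\<^sup>2\<close>, and what remains is the reciprocal of
  \<open>\<Prod>\<^sub>j (1 - \<alpha>\<^sub>j X + X\<^sup>2) = (1 + X\<^sup>N) / (1 + X)\<close> (\<open>prod_alpha_quadratics\<close>).  The coefficients of
  \<open>(1 + X) / (1 + X\<^sup>N)\<close> begin with \<open>1, 1, 0, \<dots>, 0\<close> and change sign under a shift by \<open>N\<close>; the
  difference of floor powers does the same.

  For the Lucas-type numbers it is enough to treat one \<open>\<alpha> = - 2 cos \<theta>\<close>.  With \<open>s = 1\<close> the composed series is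
  \<open>1 / (1 - \<alpha> X + X\<^sup>2)\<close>, with \<open>s = 0\<close> it is \<open>(1 + X\<^sup>2) / (1 - \<alpha> X + X\<^sup>2)\<close>, so twice the former minus
  the latter is \<open>(1 - X\<^sup>2) / (1 - \<alpha> X + X\<^sup>2)\<close>, whose coefficients are \<open>(-1)\<^sup>n 2 cos (n \<theta>)\<close>
  (\<open>cos_multiple_expansion\<close>).  Summing over the angles \<open>2 \<pi> j / N\<close> gives
  a geometric sum of roots of unity (\<open>sum_cos_multiples\<close>).
\<close>

unbundle no vec_syntax

section \<open>Products and sums over roots of unity of odd order\<close>

text \<open>Among the residues modulo \<open>2 r + 1\<close> only \<open>0\<close> is its own negative. Complex conjugation of roots of
  unity negates the index, so this splitting turns a product or sum over all of them into a real one
  over \<open>1, \<dots>, r\<close>. It is stated for commutative monoids to serve both.\<close>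

lemma (in comm_monoid_set) split_symmetric_residues:
  fixes r :: nat
  shows "F g {..<2 * r + 1} = g 0 \<^bold>* F (\<lambda>j. g j \<^bold>* g (2 * r + 1 - j)) {1..r}"
proof -
  have "{..<2 * r + 1} = insert 0 ({1..r} \<union> {r + 1..2 * r})" by auto
  then have "F g {..<2 * r + 1} = g 0 \<^bold>* (F g {1..r} \<^bold>* F g {r + 1..2 * r})"
    by (simp add: union_disjoint)
  also have "F g {r + 1..2 * r} = F (\<lambda>j. g (2 * r + 1 - j)) {1..r}"
    by (rule reindex_bij_witness[of _ "\<lambda>j. 2 * r + 1 - j" "\<lambda>j. 2 * r + 1 - j"]) auto
  finally show ?thesis by (simp add: distrib)
qed

text \<open>For odd \<open>N\<close> the roots of \<open>1 + X\<^sup>N\<close> are the negatives of the \<open>N\<close>-th roots of unity, and they are simple,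
  so the product is the factorisation of \<open>1 + X\<^sup>N\<close> evaluated at \<open>x\<close>.\<close>

lemma prod_add_odd_roots_of_unity:
  fixes x :: complex
  assumes "odd N"
  shows "(\<Prod>k<N. cis (2 * pi * real k / real N) + x) = 1 + x ^ N"
proof -
  define p :: "complex poly" where "p = 1 + monom 1 N"
  have N: "N > 0" using assms by (auto elim: oddE)
  have poly_p: "poly p z = 1 + z ^ N" for z
    by (simp add: p_def poly_monom)
  have "coeff p N = 1" "degree p = N"
  proof -
    show "coeff p N = 1" using N by (simp add: p_def)
    show "degree p = N" unfolding p_def using N
      by (subst degree_add_eq_right) (auto simp: degree_monom_eq)
  qed
  have "rsquarefree p"
    unfolding rsquarefree_roots
  proof (intro allI notI)
    fix a assume a: "poly p a = 0 \<and> poly (pderiv p) a = 0"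
    then have "of_nat N * a ^ (N - 1) = 0"
      by (simp add: p_def pderiv_add pderiv_monom poly_monom)
    then have "a = 0" using N by simp
    with a have "poly p 0 = 0" by simp
    then show False using N by (simp add: poly_p zero_power)
  qed
  have roots: "bij_betw (\<lambda>k. - cis (2 * pi * real k / real N)) {..<N} {z. poly p z = 0}"
  proof -
    have "bij_betw uminus {z::complex. z ^ N = 1} {z. poly p z = 0}"
    proof (rule bij_betw_byWitness[where f' = uminus])
      have "(- z) ^ N = - (z ^ N)" for z :: complex using assms by simp
      then show "uminus ` {z::complex. z ^ N = 1} \<subseteq> {z. poly p z = 0}"
        "uminus ` {z. poly p z = 0} \<subseteq> {z::complex. z ^ N = 1}"
        by (auto simp: poly_p add_eq_0_iff)
    qed auto
    from bij_betw_trans[OF Complex.bij_betw_roots_unity[OF N] this]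
    show ?thesis by (simp add: o_def)
  qed
  have "1 + x ^ N = poly (smult (lead_coeff p) (\<Prod>z|poly p z = 0. [:-z, 1:])) x"
    using complex_poly_decompose_rsquarefree[OF \<open>rsquarefree p\<close>] by (simp add: poly_p)
  also have "\<dots> = (\<Prod>z|poly p z = 0. - z + x)"
    using \<open>coeff p N = 1\<close> \<open>degree p = N\<close> by (simp add: poly_prod)
  also have "\<dots> = (\<Prod>k<N. cis (2 * pi * real k / real N) + x)"
    by (subst prod.reindex_bij_betw[OF roots, symmetric]) simp
  finally show ?thesis by simp
qed

lemma cis_complementary_index:
  assumes "j \<le> N" "N > 0"
  shows "cis (2 * pi * real (N - j) / real N) = cnj (cis (2 * pi * real j / real N))"
proof -
  have "2 * pi * real (N - j) / real N = 2 * pi - 2 * pi * real j / real N"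
    using assms by (simp add: of_nat_diff field_simps)
  then show ?thesis by (simp add: complex_eq_iff cos_diff sin_diff)
qed

lemma prod_one_add_two_cos_add_square:
  fixes x :: real
  shows "(1 + x) * (\<Prod>j=1..r. 1 + 2 * cos (2 * pi * real j / real (2 * r + 1)) * x + x\<^sup>2)
           = 1 + x ^ (2 * r + 1)"
proof -
  define \<zeta> where "\<zeta> k = cis (2 * pi * real k / real (2 * r + 1))" for k
  have "(\<zeta> j + of_real x) * (\<zeta> (2 * r + 1 - j) + of_real x)
        = of_real (1 + 2 * cos (2 * pi * real j / real (2 * r + 1)) * x + x\<^sup>2)"
    if "j \<in> {1..r}" for j
  proof -
    have "\<zeta> (2 * r + 1 - j) = cnj (\<zeta> j)"
      unfolding \<zeta>_def using that by (intro cis_complementary_index) auto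
    moreover have "(sin a)\<^sup>2 = 1 - (cos a)\<^sup>2" for a :: real by (rule sin_squared_eq)
    ultimately show ?thesis
      by (simp add: \<zeta>_def complex_eq_iff power2_eq_square algebra_simps)
  qed
  then have "of_real ((1 + x) * (\<Prod>j=1..r. 1 + 2 * cos (2 * pi * real j / real (2 * r + 1)) * x + x\<^sup>2))
    = (\<zeta> 0 + of_real x) * (\<Prod>j=1..r. (\<zeta> j + of_real x) * (\<zeta> (2 * r + 1 - j) + of_real x))"
    by (simp add: \<zeta>_def)
  also have "\<dots> = (\<Prod>k<2 * r + 1. \<zeta> k + of_real x)"
    by (rule prod.split_symmetric_residues[symmetric])
  also have "\<dots> = of_real (1 + x ^ (2 * r + 1))"
    unfolding \<zeta>_def by (subst prod_add_odd_roots_of_unity) auto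
  finally show ?thesis unfolding of_real_eq_iff .
qed

text \<open>The preceding identity holds at every real number, hence between polynomials, hence between power series.\<close>

lemma prod_alpha_quadratics:
  "(1 + fps_X) * (\<Prod>j=1..r. 1 - fps_const (alpha r j) * fps_X + fps_X\<^sup>2)
     = 1 + fps_X ^ (2 * r + 1)"
proof -
  have "[:1, 1:] * (\<Prod>j=1..r. [:1, - alpha r j, 1:]) = 1 + monom 1 (2 * r + 1)" (is "?p = ?q")
  proof (rule poly_eq_poly_eq_iff[THEN iffD1], rule ext)
    fix x :: real
    show "poly ?p x = poly ?q x"
      using prod_one_add_two_cos_add_square[of x r]
      by (simp add: poly_prod poly_monom alpha_def power2_eq_square algebra_simps)
  qed
  then have "fps_of_poly ?p = fps_of_poly ?q" by simp
  moreover have "fps_of_poly [:1, - alpha r j, 1:] = 1 - fps_const (alpha r j) * fps_X + fps_X\<^sup>2" for j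
    by (simp add: fps_of_poly_pCons power2_eq_square algebra_simps flip: fps_const_neg)
  moreover have "fps_of_poly [:1, 1:] = (1 + fps_X :: real fps)"
    by (simp add: fps_of_poly_pCons)
  ultimately show ?thesis
    by (simp only: fps_of_poly_mult fps_of_poly_prod fps_of_poly_add fps_of_poly_1 fps_of_poly_monom')
qed

text \<open>The numbers \<open>\<zeta>\<^sup>k\<close> with \<open>\<zeta> = cis (2 \<pi> n / N)\<close> sum to zero over a period unless \<open>\<zeta> = 1\<close>; taking real
  parts and removing the term \<open>k = 0\<close> leaves each cosine counted twice.\<close>

lemma sum_cos_multiples:
  "(\<Sum>j=1..r. 2 * cos (real n * (2 * pi * real j / real (2 * r + 1))))
     = - 1 + real (2 * r + 1) * of_bool (2 * r + 1 dvd n)"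
proof -
  define N where "N = 2 * r + 1"
  define \<zeta> where "\<zeta> = cis (2 * pi * real n / real N)"
  have N: "N > 0" by (simp add: N_def)
  have pow: "\<zeta> ^ k = cis (real n * (2 * pi * real k / real N))" for k
    unfolding \<zeta>_def Complex.DeMoivre by (rule arg_cong[of _ _ cis]) (simp add: field_simps)
  have "\<zeta> ^ N = 1"
    using N by (simp add: pow mult.commute[of "real n"] cis_multiple_2pi)
  have one_iff: "\<zeta> = 1 \<longleftrightarrow> N dvd n"
    using complex_root_unity_eq_1[of N n] N
    by (simp add: \<zeta>_def cis_conv_exp mult_ac)
  have "(\<Sum>k<N. \<zeta> ^ k) = of_nat N * of_bool (N dvd n)"
  proof (cases "N dvd n")
    case False
    then have "\<zeta> \<noteq> 1" by (simp add: one_iff)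
    then show ?thesis using False \<open>\<zeta> ^ N = 1\<close> by (simp add: sum_gp_strict)
  qed (use one_iff in simp)
  then have "Re (\<Sum>k<N. \<zeta> ^ k) = real N * of_bool (N dvd n)" by simp
  then have "(\<Sum>k<N. Re (\<zeta> ^ k)) = real N * of_bool (N dvd n)" by (simp del: of_nat_mult)
  moreover have "(\<Sum>k<N. Re (\<zeta> ^ k)) = 1 + (\<Sum>j=1..r. Re (\<zeta> ^ j) + Re (\<zeta> ^ (N - j)))"
    unfolding N_def by (subst sum.split_symmetric_residues) simp
  moreover have "Re (\<zeta> ^ (N - j)) = Re (\<zeta> ^ j)" if "j \<in> {1..r}" for j
  proof -
    have "\<zeta> ^ (N - j) * \<zeta> ^ j = 1"
      using that \<open>\<zeta> ^ N = 1\<close> by (simp add: N_def flip: power_add)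
    then have "\<zeta> ^ (N - j) = inverse (\<zeta> ^ j)" by (metis inverse_unique mult.commute)
    then show ?thesis by (simp add: pow)
  qed
  ultimately have "1 + (\<Sum>j=1..r. 2 * Re (\<zeta> ^ j)) = real N * of_bool (N dvd n)" by simp
  then show ?thesis by (simp add: pow N_def)
qed

section \<open>Generating functions in the original variable\<close>

text \<open>The terms are grouped by the exponent \<open>n - i\<close> of the last variable. Exponent vectors are
  \<open>undefined\<close> outside their index range, which is why the inverse of the grouping resets the last entry to
  \<open>undefined\<close>.\<close>

lemma complete_hom_Suc:
  "complete_hom (Suc r) n w = (\<Sum>i=0..n. complete_hom r i w * w (Suc r) ^ (n - i))"
proof -
  let ?A = "\<lambda>r n. {m. m \<in> {1..r} \<rightarrow>\<^sub>E (UNIV :: nat set) \<and> (\<Sum>j=1..r. m j) = n}"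
  have "(\<Sum>i=0..n. complete_hom r i w * w (Suc r) ^ (n - i))
        = (\<Sum>(i, m)\<in>(SIGMA i:{0..n}. ?A r i). (\<Prod>j=1..r. w j ^ m j) * w (Suc r) ^ (n - i))"
    unfolding complete_hom_def sum_distrib_right
    by (rule sum.Sigma) (use finite_complete_hom_index in auto)
  also have "\<dots> = (\<Sum>m\<in>?A (Suc r) n. \<Prod>j=1..Suc r. w j ^ m j)"
  proof (rule sum.reindex_bij_witness[of _ "\<lambda>m. (n - m (Suc r), m(Suc r := undefined))"
        "\<lambda>(i, m). m(Suc r := n - i)"], goal_cases)
    case (1 a)
    then show ?case by (auto simp: fun_eq_iff PiE_def extensional_def)
  next
    case (2 a)
    have "(\<Sum>j=1..r. (m(Suc r := n - i)) j) = (\<Sum>j=1..r. m j)" for m :: "nat \<Rightarrow> nat" and i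
      by (rule sum.cong) auto
    with 2 show ?case by (auto simp: PiE_def extensional_def)
  next
    case (3 b)
    then show ?case by auto
  next
    case (4 b)
    have "(\<Sum>j=1..r. (b(Suc r := undefined)) j) = (\<Sum>j=1..r. b j)"
      by (rule sum.cong) auto
    with 4 show ?case by (auto simp: PiE_def extensional_def)
  next
    case (5 a)
    obtain i m where a: "a = (i, m)" by (cases a)
    have "(\<Prod>j=1..r. w j ^ (m(Suc r := n - i)) j) = (\<Prod>j=1..r. w j ^ m j)"
      by (rule prod.cong) auto
    with 5 show ?case by (simp add: a)
  qed
  finally show ?thesis by (simp add: complete_hom_def)
qed

lemma fps_complete_hom:
  "Abs_fps (\<lambda>n. complete_hom r n w) = (\<Prod>j=1..r. Abs_fps (\<lambda>n. w j ^ n :: 'a :: comm_ring_1))"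
proof (induction r)
  case 0
  have "complete_hom 0 n w = (if n = 0 then 1 else 0)" for n
    by (auto simp: complete_hom_def intro!: sum.neutral)
  then show ?case by (simp add: fps_eq_iff)
next
  case (Suc r)
  have "Abs_fps (\<lambda>n. complete_hom (Suc r) n w)
     = Abs_fps (\<lambda>n. complete_hom r n w) * Abs_fps (\<lambda>n. w (Suc r) ^ n)"
    by (simp add: fps_eq_iff fps_mult_nth complete_hom_Suc)
  with Suc show ?case by simp
qed

lemma fps_geometric:
  "(1 - fps_const a * fps_X) * Abs_fps (\<lambda>n. a ^ n) = (1 :: 'a :: comm_ring_1 fps)"
proof (rule fps_ext)
  fix n
  show "((1 - fps_const a * fps_X) * Abs_fps (\<lambda>n. a ^ n)) $ n = (1 :: 'a fps) $ n"
    by (cases n) (simp_all add: left_diff_distrib mult.assoc)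
qed

section \<open>The substitution \<open>X / (1 + X\<^sup>2)\<close>\<close>

definition inv_one_plus_square :: "real fps" where
  "inv_one_plus_square = inverse (1 + fps_X\<^sup>2)"

lemma one_plus_square_mult_inv: "(1 + fps_X\<^sup>2) * inv_one_plus_square = 1"
  unfolding inv_one_plus_square_def by (rule inverse_mult_eq_1') simp

text \<open>This is the binomial series with exponent \<open>- m\<close>, evaluated at \<open>X\<^sup>2\<close>.\<close>

lemma inv_one_plus_square_power_nth:
  "(inv_one_plus_square ^ m) $ n = (if even n then (- real m) gchoose (n div 2) else 0)"
proof -
  have X2: "(fps_X\<^sup>2 :: real fps) $ 0 = 0" by simp
  have "inv_one_plus_square ^ m = fps_binomial (- of_nat m) oo fps_X\<^sup>2"
    unfolding inv_one_plus_square_def fps_binomial_minus_of_nat fps_inverse_power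
    by (simp add: fps_compose_power[OF X2, symmetric] fps_inverse_compose[OF X2] fps_compose_add_distrib)
  then have "(inv_one_plus_square ^ m) $ n = (\<Sum>i=0..n. if n = 2 * i then (- real m) gchoose i else 0)"
    by (simp add: fps_compose_nth power_mult [symmetric] if_distrib cong: if_cong)
  also have "\<dots> = (if even n then (- real m) gchoose (n div 2) else 0)"
  proof (cases "even n")
    case True
    then have "n = 2 * i \<longleftrightarrow> i = n div 2" for i by auto
    with True show ?thesis by simp
  next
    case False
    then have "n \<noteq> 2 * i" for i by auto
    with False show ?thesis by simp
  qed
  finally show ?thesis .
qed

text \<open>Since \<open>g\<^sup>i\<close> starts at degree \<open>i\<close>, the sum defining each coefficient of \<open>f oo g\<close> up to the \<open>n\<close>-th may be
  extended to the common range \<open>0, \<dots>, n\<close>; the two finite sums can then be exchanged.\<close>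

lemma fps_compose_mult_nth:
  fixes f g h :: "'a :: comm_ring_1 fps"
  assumes "g $ 0 = 0"
  shows "((f oo g) * h) $ n = (\<Sum>i=0..n. f $ i * (g ^ i * h) $ n)"
proof -
  have "(f oo g) $ j = (\<Sum>i=0..n. f $ i * (g ^ i) $ j)" if "j \<le> n" for j
    unfolding fps_compose_nth using that assms
    by (intro sum.mono_neutral_left) (auto simp: startsby_zero_power_prefix)
  then have "((f oo g) * h) $ n = (\<Sum>j=0..n. \<Sum>i=0..n. f $ i * ((g ^ i) $ j * h $ (n - j)))"
    by (simp add: fps_mult_nth sum_distrib_right mult.assoc)
  also have "\<dots> = (\<Sum>i=0..n. f $ i * (g ^ i * h) $ n)"
    by (subst sum.swap) (simp add: fps_mult_nth sum_distrib_left)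
  finally show ?thesis .
qed

text \<open>The parity condition on the coefficients of powers of \<open>1 / (1 + X\<^sup>2)\<close> leaves only the indices
  \<open>i = n - 2 k\<close>. Both identities of the theorem have left-hand sides of this shape: \<open>s = r\<close> for the
  Fibonacci-type one, \<open>s = 1\<close> and \<open>s = 0\<close> for the Lucas-type one.\<close>

lemma compose_X_over_one_plus_square_nth:
  "((f oo (fps_X * inv_one_plus_square)) * inv_one_plus_square ^ s) $ n
     = (\<Sum>k=0..n div 2. ((- real (n - 2 * k + s)) gchoose k) * f $ (n - 2 * k))"
proof -
  have "((f oo (fps_X * inv_one_plus_square)) * inv_one_plus_square ^ s) $ n
      = (\<Sum>i=0..n. f $ i * (fps_X ^ i * inv_one_plus_square ^ (i + s)) $ n)"
    by (subst fps_compose_mult_nth) (simp_all add: power_mult_distrib power_add mult.assoc)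
  also have "\<dots> = (\<Sum>i=0..n. if even (n - i) then ((- real (i + s)) gchoose ((n - i) div 2)) * f $ i else 0)"
    by (intro sum.cong refl) (simp add: fps_X_power_mult_nth inv_one_plus_square_power_nth)
  also have "\<dots> = (\<Sum>i | i \<in> {0..n} \<and> even (n - i). ((- real (i + s)) gchoose ((n - i) div 2)) * f $ i)"
    by (rule sum.inter_filter[symmetric]) simp
  also have "\<dots> = (\<Sum>k=0..n div 2. ((- real (n - 2 * k + s)) gchoose k) * f $ (n - 2 * k))"
    by (rule sum.reindex_bij_witness[of _ "\<lambda>k. n - 2 * k" "\<lambda>i. (n - i) div 2"])
       (auto simp: add.commute[of s] simp del: of_nat_add of_nat_diff)
  finally show ?thesis .
qed

text \<open>Substituting into \<open>1 / (1 - a x)\<close> gives \<open>(1 + X\<^sup>2) / (1 - a X + X\<^sup>2)\<close>; the additional factor removes the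
  numerator.\<close>

lemma quadratic_mult_geometric_compose:
  fixes a :: real
  shows "(1 - fps_const a * fps_X + fps_X\<^sup>2) * ((Abs_fps (\<lambda>n. a ^ n) oo (fps_X * inv_one_plus_square)) * inv_one_plus_square) = 1"
proof -
  let ?g = "fps_X * inv_one_plus_square" and ?f = "Abs_fps (\<lambda>n. a ^ n)"
  have g0: "?g $ 0 = 0" by simp
  have "(1 - fps_const a * ?g) * (?f oo ?g) = ((1 - fps_const a * fps_X) * ?f) oo ?g"
    by (simp add: fps_compose_mult_distrib[OF g0] fps_compose_sub_distrib)
  then have one: "(1 - fps_const a * ?g) * (?f oo ?g) = 1" by (simp add: fps_geometric)
  have "1 - fps_const a * fps_X + fps_X\<^sup>2 = (1 + fps_X\<^sup>2) * (1 - fps_const a * ?g)"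
    using one_plus_square_mult_inv by algebra
  then show ?thesis using one_plus_square_mult_inv one by algebra
qed

section \<open>The identity for complete homogeneous sums\<close>

definition periodic_sign :: "nat \<Rightarrow> nat \<Rightarrow> real" where
  "periodic_sign r n = 1 / 2 * ((-1) powi \<lfloor>real n / real (2 * r + 1)\<rfloor>
                             - (-1) powi \<lfloor>(real n - 2) / real (2 * r + 1)\<rfloor>)"

text \<open>Adding \<open>2 r + 1\<close> to \<open>n\<close> raises both floors by one, so each power of \<open>-1\<close> changes its sign.\<close>

lemma periodic_sign_shift: "periodic_sign r (n + (2 * r + 1)) = - periodic_sign r n"
proof -
  have "real (n + (2 * r + 1)) / real (2 * r + 1) = real n / real (2 * r + 1) + 1"
    "(real (n + (2 * r + 1)) - 2) / real (2 * r + 1) = (real n - 2) / real (2 * r + 1) + 1"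
    by (simp_all add: field_simps)
  then show ?thesis
    unfolding periodic_sign_def by (simp only: one_add_floor[symmetric]) (simp add: power_int_add_1 diff_divide_distrib)
qed

text \<open>Within the first period the first floor is \<open>0\<close>, and the second is \<open>-1\<close> exactly for \<open>n = 0\<close> and \<open>n = 1\<close>.
  The bound \<open>r \<ge> 1\<close> keeps \<open>(n - 2) / (2 r + 1)\<close> from falling below \<open>-1\<close>.\<close>

lemma periodic_sign_initial:
  assumes "r \<ge> 1" "n < 2 * r + 1"
  shows "periodic_sign r n = of_bool (n < 2)"
proof -
  have "\<lfloor>real n / real (2 * r + 1)\<rfloor> = 0"
    using assms by (simp add: floor_eq_iff)
  moreover have "\<lfloor>(real n - 2) / real (2 * r + 1)\<rfloor> = (if n < 2 then - 1 else 0)"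
    using assms by (auto simp: floor_eq_iff field_simps)
  ultimately show ?thesis by (simp add: periodic_sign_def)
qed

text \<open>Two shifts by \<open>2 r + 1\<close> restore the sign, so only the residue modulo \<open>4 r + 2\<close> counts, and a residue in the
  upper half is one shift away from the initial period.\<close>

lemma periodic_sign_eq_cases:
  assumes "r \<ge> 1"
  shows "periodic_sign r n = (if [n = 0] (mod 4 * r + 2) \<or> [n = 1] (mod 4 * r + 2) then 1
           else if [n = 2 * r + 1] (mod 4 * r + 2) \<or> [n = 2 * r + 2] (mod 4 * r + 2) then - 1
           else 0)"
proof -
  define m q where "m = n mod (4 * r + 2)" and "q = n div (4 * r + 2)"
  have m: "m < 4 * r + 2" by (simp add: m_def)
  have "periodic_sign r (i + q * (4 * r + 2)) = periodic_sign r i" for i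
  proof (induction q)
    case (Suc q)
    have "i + Suc q * (4 * r + 2) = i + q * (4 * r + 2) + (2 * r + 1) + (2 * r + 1)" by simp
    then show ?case using Suc by (simp only: periodic_sign_shift minus_minus)
  qed simp
  from this[of m] have periodic: "periodic_sign r n = periodic_sign r m"
    by (metis m_def q_def mod_div_mult_eq)
  have "periodic_sign r m = (if m = 0 \<or> m = 1 then 1 else if m = 2 * r + 1 \<or> m = 2 * r + 2 then - 1 else 0)"
  proof (cases "m < 2 * r + 1")
    case True
    then show ?thesis using assms by (auto simp: periodic_sign_initial)
  next
    case False
    define i where "i = m - (2 * r + 1)"
    have "m = i + (2 * r + 1)" "i < 2 * r + 1" using m False by (simp_all add: i_def)
    moreover from this have "periodic_sign r m = - of_bool (i < 2)"
      using assms by (simp only: periodic_sign_shift periodic_sign_initial)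
    ultimately show ?thesis using assms by auto
  qed
  then show ?thesis using assms by (simp add: periodic cong_def m_def)
qed

text \<open>In the product, the coefficient of \<open>X\<^sup>n\<close> adds the values at \<open>n\<close> and \<open>n - (2 r + 1)\<close>, which cancel as soon
  as both are present.\<close>

lemma fps_periodic_sign:
  assumes "r \<ge> 1"
  shows "(1 + fps_X ^ (2 * r + 1)) * Abs_fps (periodic_sign r) = 1 + fps_X"
proof (rule fps_ext)
  fix n
  have rhs: "(1 + fps_X :: real fps) $ n = of_bool (n < 2)" by (auto simp: fps_X_def)
  show "((1 + fps_X ^ (2 * r + 1)) * Abs_fps (periodic_sign r)) $ n = (1 + fps_X) $ n"
  proof (cases "n < 2 * r + 1")
    case True
    then show ?thesis unfolding rhs distrib_right fps_add_nth fps_X_power_mult_nth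
      using assms by (simp add: periodic_sign_initial)
  next
    case False
    then have "periodic_sign r n = - periodic_sign r (n - (2 * r + 1))"
      using periodic_sign_shift[of r "n - (2 * r + 1)"] by simp
    with False show ?thesis unfolding rhs distrib_right fps_add_nth fps_X_power_mult_nth
      using assms by simp
  qed
qed

text \<open>Each of the \<open>r\<close> factors of \<open>(1 + X\<^sup>2)\<^sup>-\<^sup>r\<close> is paired with one geometric series, so that all quadratics
  \<open>1 - \<alpha>\<^sub>j X + X\<^sup>2\<close> are inverted at once. Multiplied by \<open>1 + X\<^sup>N\<close>, with \<open>N = 2 r + 1\<close>, the two sides then
  have the same product \<open>1 + X\<close>, and \<open>1 + X\<^sup>N\<close> can be cancelled.\<close>

lemma sum_genfib_eq_periodic_sign:
  assumes "r \<ge> 1"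
  shows "(\<Sum>k=0..n div 2. (-1) ^ k * ((real n - real k + real r - 1) gchoose k) * genfib r (n - 2 * k + 1))
           = periodic_sign r n"
proof -
  let ?g = "fps_X * inv_one_plus_square"
  let ?f = "\<lambda>j. Abs_fps (\<lambda>n. alpha r j ^ n)"
  let ?q = "\<lambda>j. 1 - fps_const (alpha r j) * fps_X + fps_X\<^sup>2"
  define H where "H = Abs_fps (\<lambda>n. complete_hom r n (alpha r))"
  define S where "S = (H oo ?g) * inv_one_plus_square ^ r"
  have g0: "?g $ 0 = 0" by simp
  have "S = (\<Prod>j=1..r. (?f j oo ?g) * inv_one_plus_square)"
    unfolding S_def H_def fps_complete_hom fps_compose_prod_distrib[OF g0] by (simp add: prod.distrib)
  then have "(\<Prod>j=1..r. ?q j) * S = (\<Prod>j=1..r. ?q j * ((?f j oo ?g) * inv_one_plus_square))"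
    by (simp only: prod.distrib)
  also have "\<dots> = 1" by (simp only: quadratic_mult_geometric_compose prod.neutral_const)
  finally have "(1 + fps_X ^ (2 * r + 1)) * S = 1 + fps_X"
    unfolding prod_alpha_quadratics[symmetric] by (simp add: mult.assoc)
  with fps_periodic_sign[OF assms]
  have "(1 + fps_X ^ (2 * r + 1)) * S = (1 + fps_X ^ (2 * r + 1)) * Abs_fps (periodic_sign r)" by simp
  moreover have "(1 + fps_X ^ (2 * r + 1) :: real fps) \<noteq> 0"
  proof
    assume "(1 + fps_X ^ (2 * r + 1) :: real fps) = 0"
    then have "(1 + fps_X ^ (2 * r + 1) :: real fps) $ 0 = 0" by simp
    then show False by simp
  qed
  ultimately have "S = Abs_fps (periodic_sign r)" by simp
  then have "periodic_sign r n = S $ n" by simp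
  also have "\<dots> = (\<Sum>k=0..n div 2. ((- real (n - 2 * k + r)) gchoose k) * H $ (n - 2 * k))"
    unfolding S_def by (rule compose_X_over_one_plus_square_nth)
  also have "\<dots> = (\<Sum>k=0..n div 2. (-1) ^ k * ((real n - real k + real r - 1) gchoose k) * genfib r (n - 2 * k + 1))"
  proof (intro sum.cong refl)
    fix k assume "k \<in> {0..n div 2}"
    then have *: "real (n - 2 * k + r) + real k - 1 = real n - real k + real r - 1"
      by (auto simp: of_nat_diff)
    then show "((- real (n - 2 * k + r)) gchoose k) * H $ (n - 2 * k)
       = (-1) ^ k * ((real n - real k + real r - 1) gchoose k) * genfib r (n - 2 * k + 1)"
      by (simp only: gbinomial_minus *) (simp add: H_def)
  qed
  finally show ?thesis ..
qed

section \<open>The identity for power sums\<close>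

text \<open>Up to the alternating signs, multiplication by the quadratic encodes the recurrence
  \<open>cos ((k + 2) \<theta>) = 2 cos \<theta> cos ((k + 1) \<theta>) - cos (k \<theta>)\<close>, which annihilates all coefficients from \<open>X\<^sup>3\<close> on.
  The constant coefficient is \<open>1\<close> and not \<open>2 cos 0 = 2\<close>; this shifts the product by \<open>- (1 - \<alpha> X + X\<^sup>2)\<close>, where
  \<open>\<alpha> = - 2 cos \<theta>\<close>, and is what makes it equal to \<open>1 - X\<^sup>2\<close>.\<close>

lemma fps_cos_multiples:
  "(1 - fps_const (- 2 * cos \<theta>) * fps_X + fps_X\<^sup>2)
     * Abs_fps (\<lambda>n. if n = 0 then 1 else (-1) ^ n * (2 * cos (real n * \<theta>))) = (1 - fps_X\<^sup>2 :: real fps)"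
  (is "?q * ?G = _")
proof (rule fps_ext)
  fix n :: nat
  have coeff: "(?q * ?G) $ n = ?G $ n + (if n < 1 then 0 else 2 * cos \<theta> * ?G $ (n - 1))
          + (if n < 2 then 0 else ?G $ (n - 2))" for n
    by (simp add: distrib_right left_diff_distrib mult.assoc fps_X_power_mult_nth)
  have "n = 0 \<or> n = 1 \<or> n = 2 \<or> (\<exists>k. n = k + 3)" by presburger
  then consider "n = 0" | "n = 1" | "n = 2" | k where "n = k + 3" by blast
  then show "(?q * ?G) $ n = (1 - fps_X\<^sup>2) $ n"
  proof cases
    case 3
    then show ?thesis unfolding coeff by (simp add: cos_double_cos power2_eq_square)
  next
    case (4 k)
    have "cos (real (k + 3) * \<theta>) + cos (real (k + 1) * \<theta>) = 2 * cos \<theta> * cos (real (k + 2) * \<theta>)"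
    proof -
      have "real (k + 3) * \<theta> = real (k + 2) * \<theta> + \<theta>" "real (k + 1) * \<theta> = real (k + 2) * \<theta> - \<theta>"
        by (simp_all add: algebra_simps)
      then show ?thesis by (simp only: cos_add cos_diff) simp
    qed
    then have "(-1) ^ k * (cos (real (k + 3) * \<theta>) + cos (real (k + 1) * \<theta>))
        = (-1) ^ k * (2 * cos \<theta> * cos (real (k + 2) * \<theta>))" by simp
    then show ?thesis unfolding coeff using 4
      by (simp add: power_add numeral_eq_Suc algebra_simps)
  qed (simp_all add: coeff)
qed

text \<open>The first sum is the \<open>n\<close>-th coefficient of \<open>A = 1 / (1 - \<alpha> X + X\<^sup>2)\<close>, where \<open>\<alpha> = - 2 cos \<theta>\<close>, and the second
  that of \<open>B = (1 + X\<^sup>2) A\<close>, so the left-hand side is a coefficient of \<open>(1 - X\<^sup>2) A\<close>.\<close>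

lemma cos_multiple_expansion:
  fixes \<theta> :: real
  assumes "n \<ge> 1"
  shows "2 * (\<Sum>k=0..n div 2. ((2 * real k - real n - 1) gchoose k) * (- 2 * cos \<theta>) ^ (n - 2 * k))
           - (\<Sum>k=0..n div 2. ((2 * real k - real n) gchoose k) * (- 2 * cos \<theta>) ^ (n - 2 * k))
         = (-1) ^ n * (2 * cos (real n * \<theta>))"
proof -
  define a where "a = - 2 * cos \<theta>"
  let ?f = "Abs_fps (\<lambda>n. a ^ n)" and ?g = "fps_X * inv_one_plus_square"
  let ?q = "1 - fps_const a * fps_X + fps_X\<^sup>2"
  define G where "G = Abs_fps (\<lambda>n. if n = 0 then 1 else (-1) ^ n * (2 * cos (real n * \<theta>)))"
  define A where "A = (?f oo ?g) * inv_one_plus_square ^ 1"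
  define B where "B = (?f oo ?g) * inv_one_plus_square ^ 0"
  have qA: "?q * A = 1" using quadratic_mult_geometric_compose[of a] by (simp add: A_def)
  have "B = (1 + fps_X\<^sup>2) * A" using one_plus_square_mult_inv unfolding A_def B_def by algebra
  then have "?q * (2 * A - B) = 1 - fps_X\<^sup>2" using qA by algebra
  moreover have "?q * G = 1 - fps_X\<^sup>2" unfolding G_def a_def by (rule fps_cos_multiples)
  moreover have "?q \<noteq> 0"
  proof
    assume "?q = 0"
    with qA have "(0 :: real fps) = 1" by (metis mult_zero_left)
    then show False by simp
  qed
  ultimately have "2 * A - B = G" by (metis mult_left_cancel)
  then have "2 * A $ n - B $ n = G $ n"
    by (metis fps_sub_nth fps_mult_left_const_nth numeral_fps_const)
  moreover have "A $ n = (\<Sum>k=0..n div 2. ((2 * real k - real n - 1) gchoose k) * a ^ (n - 2 * k))"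
    unfolding A_def compose_X_over_one_plus_square_nth
    by (intro sum.cong refl) (auto simp: of_nat_diff algebra_simps)
  moreover have "B $ n = (\<Sum>k=0..n div 2. ((2 * real k - real n) gchoose k) * a ^ (n - 2 * k))"
    unfolding B_def compose_X_over_one_plus_square_nth
    by (intro sum.cong refl) (auto simp: of_nat_diff algebra_simps)
  ultimately show ?thesis using assms by (simp add: G_def a_def)
qed

lemma sum_genluc_eq:
  assumes "n \<ge> 1"
  shows "2 * (\<Sum>k=0..n div 2. ((2 * real k - real n - 1) gchoose k) * genluc r (n - 2 * k))
           - (\<Sum>k=0..n div 2. ((2 * real k - real n) gchoose k) * genluc r (n - 2 * k))
         = (-1) ^ n * (- 1 + real (2 * r + 1) * of_bool (2 * r + 1 dvd n))"
proof -
  have swap: "(\<Sum>k=0..n div 2. c k * genluc r (n - 2 * k))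
    = (\<Sum>j=1..r. \<Sum>k=0..n div 2. c k * (- 2 * cos (2 * pi * real j / real (2 * r + 1))) ^ (n - 2 * k))"
    for c :: "nat \<Rightarrow> real"
    unfolding genluc_def power_sum_def alpha_def sum_distrib_left by (rule sum.swap)
  let ?a = "\<lambda>j. - 2 * cos (2 * pi * real j / real (2 * r + 1))"
  have "2 * (\<Sum>k=0..n div 2. ((2 * real k - real n - 1) gchoose k) * genluc r (n - 2 * k))
           - (\<Sum>k=0..n div 2. ((2 * real k - real n) gchoose k) * genluc r (n - 2 * k))
      = (\<Sum>j=1..r. 2 * (\<Sum>k=0..n div 2. ((2 * real k - real n - 1) gchoose k) * ?a j ^ (n - 2 * k))
           - (\<Sum>k=0..n div 2. ((2 * real k - real n) gchoose k) * ?a j ^ (n - 2 * k)))"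
    by (simp only: swap sum_subtractf sum_distrib_left[of 2])
  also have "\<dots> = (-1) ^ n * (\<Sum>j=1..r. 2 * cos (real n * (2 * pi * real j / real (2 * r + 1))))"
    by (simp only: cos_multiple_expansion[OF assms] sum_distrib_left[of "(-1) ^ n"])
  finally show ?thesis by (simp only: sum_cos_multiples)
qed

theorem theorem4:
  fixes r :: nat
  assumes "r \<ge> 1"
  shows "(\<forall>n::nat.
            (\<Sum>k=0..n div 2. (-1) ^ k * ((real n - real k + real r - 1) gchoose k) * genfib r (n - 2 * k + 1))
              = 1 / 2 * ((-1) powi \<lfloor>real n / real (2 * r + 1)\<rfloor>
                         - (-1) powi \<lfloor>(real n - 2) / real (2 * r + 1)\<rfloor>)
          \<and> 1 / 2 * ((-1) powi \<lfloor>real n / real (2 * r + 1)\<rfloor>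
                       - (-1) powi \<lfloor>(real n - 2) / real (2 * r + 1)\<rfloor>)
              = (if [n = 0] (mod 4 * r + 2) \<or> [n = 1] (mod 4 * r + 2) then 1
                 else if [n = 2 * r + 1] (mod 4 * r + 2) \<or> [n = 2 * r + 2] (mod 4 * r + 2) then - 1
                 else (0 :: real)))
       \<and> (\<forall>n::nat. n \<ge> 1 \<longrightarrow>
            2 * (\<Sum>k=0..(n + 1) div 2.
                   if 2 * k \<le> n then ((2 * real k - real n - 1) gchoose k) * genluc r (n - 2 * k) else 0)
              - (\<Sum>k=0..n div 2. ((2 * real k - real n) gchoose k) * genluc r (n - 2 * k))
              = (-1) ^ n * (- 1 + real (2 * r + 1) * of_bool (2 * r + 1 dvd n))
          \<and> (-1) ^ n * (- 1 + real (2 * r + 1) * of_bool (2 * r + 1 dvd n))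
              = (if 2 * r + 1 dvd n then (-1) ^ n * (2 * real r) else (-1) ^ (n - 1)))"
proof (intro conjI allI impI)
  fix n :: nat
  show "(\<Sum>k=0..n div 2. (-1) ^ k * ((real n - real k + real r - 1) gchoose k) * genfib r (n - 2 * k + 1))
          = 1 / 2 * ((-1) powi \<lfloor>real n / real (2 * r + 1)\<rfloor>
                     - (-1) powi \<lfloor>(real n - 2) / real (2 * r + 1)\<rfloor>)"
    using sum_genfib_eq_periodic_sign[OF assms] unfolding periodic_sign_def .
  show "1 / 2 * ((-1) powi \<lfloor>real n / real (2 * r + 1)\<rfloor>
                   - (-1) powi \<lfloor>(real n - 2) / real (2 * r + 1)\<rfloor>)
          = (if [n = 0] (mod 4 * r + 2) \<or> [n = 1] (mod 4 * r + 2) then 1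
             else if [n = 2 * r + 1] (mod 4 * r + 2) \<or> [n = 2 * r + 2] (mod 4 * r + 2) then - 1
             else (0 :: real))"
    using periodic_sign_eq_cases[OF assms] unfolding periodic_sign_def .
next
  fix n :: nat assume n: "n \<ge> 1"
  have "(\<Sum>k=0..(n + 1) div 2.
           if 2 * k \<le> n then ((2 * real k - real n - 1) gchoose k) * genluc r (n - 2 * k) else 0)
        = (\<Sum>k=0..n div 2. ((2 * real k - real n - 1) gchoose k) * genluc r (n - 2 * k))"
    by (rule sum.mono_neutral_cong_right) auto
  then show "2 * (\<Sum>k=0..(n + 1) div 2.
               if 2 * k \<le> n then ((2 * real k - real n - 1) gchoose k) * genluc r (n - 2 * k) else 0)
          - (\<Sum>k=0..n div 2. ((2 * real k - real n) gchoose k) * genluc r (n - 2 * k))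
        = (-1) ^ n * (- 1 + real (2 * r + 1) * of_bool (2 * r + 1 dvd n))"
    using sum_genluc_eq[OF n] by simp
  show "(-1) ^ n * (- 1 + real (2 * r + 1) * of_bool (2 * r + 1 dvd n))
          = (if 2 * r + 1 dvd n then (-1) ^ n * (2 * real r) else (-1) ^ (n - 1))"
    using n by (cases n) auto
qed

end
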